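(* Let $m\ge 2$, $s\ge 1$ and let $X_1,\dots,X_m\in\mathbb{Z}^s$ (not necessarily distinct) span $\mathbb{R}^s$ and satisfy $\langle X_j,\alpha\rangle>0$ for all $j$, for some $\alpha\in\mathbb{R}^s$. Let $\mathcal{J}$, $\mathbf{C}_X$ and the multiplicity $\mathbf{m}$ be as in the context. Then for every unit vector $\theta\in\mathbf{C}_X$ the limit $$\gamma(\theta)=\lim_{k\to\infty}\frac{\log\mathbf{m}(k\theta)}{k}$$ exists.
   Context: $\mathcal{J}=X_1\mathbb{N}+\dots+X_m\mathbb{N}$ with $\mathbb{N}=\{0,1,2,\dots\}$, and $\mathbf{C}_X=X_1\mathbb{R}^++\dots+X_m\mathbb{R}^+$. For $z\in\mathcal{J}$, $\mathbf{m}(z)$ is the number of finite words $i_1\cdots i_n$ ($n\ge 0$, $i_k\in\{1,\dots,m\}$) with $X_{i_1}+\dots+X_{i_n}=z$. For $x\in\mathbf{C}_X$, $\mathbf{m}(x)=\min\{\mathbf{m}(z): z\in\mathcal{J},\ \|x-z\|=d(x,\mathcal{J})\}$, where $\|\cdot\|$ is the Euclidean norm and $d(x,\mathcal{J})=\min\{\|x-z\|:z\in\mathcal{J}\}$ (this agrees with the previous definition on $\mathcal{J}$). *)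

theory Defs
  imports "HOL-Analysis.Analysis"
begin

(* The vectors are X 1, ..., X m; the values of X outside {1..m} are irrelevant. *)

definition semigroup_J :: "nat \<Rightarrow> (nat \<Rightarrow> real ^ 's) \<Rightarrow> (real ^ 's) set" where
  "semigroup_J m X = {\<Sum>j=1..m. real (n j) *\<^sub>R X j | n :: nat \<Rightarrow> nat. True}"

definition cone_C :: "nat \<Rightarrow> (nat \<Rightarrow> real ^ 's) \<Rightarrow> (real ^ 's) set" where
  "cone_C m X = {\<Sum>j=1..m. c j *\<^sub>R X j | c :: nat \<Rightarrow> real. \<forall>j\<in>{1..m}. 0 \<le> c j}"

(* The set of words is finite, so that card is the true count, as soon as all X j lie in
   an open half-space through the origin: this bounds the length of the words. *)
definition word_mult :: "nat \<Rightarrow> (nat \<Rightarrow> real ^ 's) \<Rightarrow> real ^ 's \<Rightarrow> nat" where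
  "word_mult m X z = card {w :: nat list. set w \<subseteq> {1..m} \<and> sum_list (map X w) = z}"

(* For integral X j the semigroup is closed and discrete, so infdist is an attained minimum;
   Inf on nat is the least element of the nonempty set. *)
definition nearest_mult :: "nat \<Rightarrow> (nat \<Rightarrow> real ^ 's) \<Rightarrow> real ^ 's \<Rightarrow> nat" where
  "nearest_mult m X x =
     Inf (word_mult m X ` {z \<in> semigroup_J m X. norm (x - z) = infdist x (semigroup_J m X)})"

end

theory Submission
  imports Defs
begin

text \<open>
  Since \<open>\<alpha>\<close> is positive on all letters, concatenation of words is injective, so
  the number of words is supermultiplicative: \<open>m (x + y) \<ge> m x * m y\<close>. The limit follows as in
  Fekete's lemma, provided that, for large \<open>k0\<close>, every point \<open>z\<close> of the semigroup near
  \<open>k *\<^sub>R \<theta>\<close> contains about \<open>k / k0\<close> copies of a point \<open>x\<close> near \<open>k0 *\<^sub>R \<theta>\<close>, with a remainder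
  that is again in the semigroup.

  Let \<open>S\<close> be the letters in the minimal face of the cone containing \<open>\<theta>\<close>. Words whose sum is near
  \<open>k *\<^sub>R \<theta>\<close> have a bounded number of letters outside \<open>S\<close>, and deleting them changes the
  number of words by a polynomial factor only. Inside the face, \<open>\<theta>\<close> has a representation with
  positive coefficients, and an integer combination \<open>w\<close> of the vectors of \<open>S\<close> has integer
  coefficients of size \<open>O(1 + norm w)\<close>. Taking \<open>(1 - e) * k / k0\<close> copies of \<open>x\<close> therefore leaves a
  remainder all of whose coefficients can be made nonnegative.
\<close>

section \<open>Counting words\<close>

text \<open>The alphabet \<open>S\<close> is a parameter so that words over all letters can be
  compared with words over the letters of a face.\<close>

definition words :: "nat set \<Rightarrow> (nat \<Rightarrow> 'a::comm_monoid_add) \<Rightarrow> 'a \<Rightarrow> nat list set" where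
  "words S X z = {w. set w \<subseteq> S \<and> sum_list (map X w) = z}"

lemma word_mult_eq_card_words: "word_mult m X z = card (words {1..m} X z)"
  by (simp add: word_mult_def words_def)

text \<open>The sum of a word depends only on how often each letter occurs, and any multiplicities
  are realised by concatenating constant blocks. Membership in the semigroup thus becomes a matter
  of nonnegative integer coefficients.\<close>

lemma words_nonempty_iff:
  fixes X :: "nat \<Rightarrow> 'a::real_vector"
  assumes "finite S"
  shows "words S X z \<noteq> {} \<longleftrightarrow> (\<exists>n :: nat \<Rightarrow> nat. z = (\<Sum>j\<in>S. real (n j) *\<^sub>R X j))"
proof
  assume "words S X z \<noteq> {}"
  then obtain w where w: "set w \<subseteq> S" "sum_list (map X w) = z"
    by (auto simp: words_def)
  have "sum_list (map X w) = (\<Sum>j\<in>S. real (count_list w j) *\<^sub>R X j)"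
    using w(1)
  proof (induction w)
    case (Cons i w)
    have "(\<Sum>j\<in>S. real (count_list (i # w) j) *\<^sub>R X j)
        = (\<Sum>j\<in>S. (if i = j then X j else 0) + real (count_list w j) *\<^sub>R X j)"
      by (intro sum.cong) (auto simp: algebra_simps)
    also have "\<dots> = X i + (\<Sum>j\<in>S. real (count_list w j) *\<^sub>R X j)"
      using Cons.prems assms by (simp add: sum.distrib)
    finally show ?case using Cons by simp
  qed simp
  then show "\<exists>n. z = (\<Sum>j\<in>S. real (n j) *\<^sub>R X j)" using w by auto
next
  assume "\<exists>n :: nat \<Rightarrow> nat. z = (\<Sum>j\<in>S. real (n j) *\<^sub>R X j)"
  then obtain n :: "nat \<Rightarrow> nat" where n: "z = (\<Sum>j\<in>S. real (n j) *\<^sub>R X j)" by auto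
  have "\<exists>w. set w \<subseteq> S \<and> sum_list (map X w) = (\<Sum>j\<in>S. real (n j) *\<^sub>R X j)"
    using assms
  proof (induction S)
    case (insert i S)
    then obtain w where w: "set w \<subseteq> S" "sum_list (map X w) = (\<Sum>j\<in>S. real (n j) *\<^sub>R X j)"
      by auto
    have "sum_list (replicate k x) = real k *\<^sub>R x" for k and x :: 'a
      by (induction k) (auto simp: algebra_simps)
    then have "sum_list (map X (replicate (n i) i @ w)) = (\<Sum>j\<in>insert i S. real (n j) *\<^sub>R X j)"
      using insert.hyps w by simp
    moreover have "set (replicate (n i) i @ w) \<subseteq> insert i S" using w by auto
    ultimately show ?case by blast
  qed auto
  then show "words S X z \<noteq> {}" by (auto simp: words_def n)
qed

lemma filter_in_words:
  fixes X :: "nat \<Rightarrow> 'a::ab_group_add"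
  assumes "w \<in> words I X z"
  shows "filter (\<lambda>j. j \<in> S) w \<in> words S X (z - sum_list (map X (filter (\<lambda>j. j \<notin> S) w)))"
proof -
  have "sum_list (map X (filter (\<lambda>j. j \<in> S) w)) + sum_list (map X (filter (\<lambda>j. j \<notin> S) w))
      = sum_list (map X w)"
    by (induction w) (auto simp: algebra_simps)
  then show ?thesis using assms by (auto simp: words_def algebra_simps)
qed

lemma norm_sum_list_map_le:
  fixes X :: "nat \<Rightarrow> 'a::real_normed_vector"
  assumes "set u \<subseteq> I" "\<And>j. j \<in> I \<Longrightarrow> norm (X j) \<le> E"
  shows "norm (sum_list (map X u)) \<le> real (length u) * E"
  using assms(1)
proof (induction u)
  case (Cons i u)
  have "norm (X i + sum_list (map X u)) \<le> norm (X i) + norm (sum_list (map X u))"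
    by (rule norm_triangle_ineq)
  also have "\<dots> \<le> E + real (length u) * E" using Cons assms(2)[of i] by (intro add_mono) auto
  finally show ?case by (simp add: algebra_simps)
qed simp

lemma semigroup_J_eq: "semigroup_J m X = {z. words {1..m} X z \<noteq> {}}"
  unfolding semigroup_J_def words_nonempty_iff[OF finite_atLeastAtMost] by simp

section \<open>Words over letters in an open half-space\<close>

text \<open>The uniform margin \<delta> bounds the length of a word linearly in the inner product of
  its sum with \<alpha>.\<close>

locale half_space_vectors =
  fixes I :: "nat set" and X :: "nat \<Rightarrow> 'a::euclidean_space" and \<alpha> :: 'a and \<delta> :: real
  assumes finite_I: "finite I" and \<delta>_pos: "\<delta> > 0"
    and \<delta>_le: "\<And>j. j \<in> I \<Longrightarrow> \<delta> \<le> X j \<bullet> \<alpha>"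
begin

lemma length_le_inner:
  assumes "set w \<subseteq> I"
  shows "\<delta> * real (length w) \<le> sum_list (map X w) \<bullet> \<alpha>"
  using assms
proof (induction w)
  case (Cons i w)
  then show ?case using \<delta>_le[of i] by (simp add: algebra_simps)
qed simp

lemma words_length_bound:
  assumes "w \<in> words I X z"
  shows "length w \<le> nat \<lfloor>(z \<bullet> \<alpha>) / \<delta>\<rfloor>"
proof (rule le_nat_floor)
  show "real (length w) \<le> (z \<bullet> \<alpha>) / \<delta>"
    using length_le_inner[of w] assms \<delta>_pos by (simp add: words_def pos_le_divide_eq mult.commute)
qed

lemma finite_words: "S \<subseteq> I \<Longrightarrow> finite (words S X z)"
proof (rule finite_subset)
  assume "S \<subseteq> I"
  then show "words S X z \<subseteq> {w. set w \<subseteq> I \<and> length w \<le> nat \<lfloor>(z \<bullet> \<alpha>) / \<delta>\<rfloor>}"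
    using words_length_bound[of _ z] by (auto simp: words_def)
  show "finite {w. set w \<subseteq> I \<and> length w \<le> nat \<lfloor>(z \<bullet> \<alpha>) / \<delta>\<rfloor>}"
    by (rule finite_lists_length_le[OF finite_I])
qed

text \<open>Keeps the quotients in the limit bounded: only lengths up to a linear bound occur, so
  the count is at most exponential.\<close>

lemma card_words_le: "card (words I X z) \<le> (card I + 1) ^ nat \<lfloor>(z \<bullet> \<alpha>) / \<delta>\<rfloor>"
proof -
  let ?N = "nat \<lfloor>(z \<bullet> \<alpha>) / \<delta>\<rfloor>"
  have "words I X z \<subseteq> {w. set w \<subseteq> I \<and> length w \<le> ?N}"
    using words_length_bound[of _ z] by (auto simp: words_def)
  then have "card (words I X z) \<le> (\<Sum>i\<le>?N. card I ^ i)"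
    using card_mono[OF finite_lists_length_le[OF finite_I]] card_lists_length_le[OF finite_I]
    by metis
  \<comment> \<open>The binomial coefficients that occur are at least 1, so the geometric sum is
    dominated by a binomial expansion with a closed form.\<close>
  also have "\<dots> \<le> (\<Sum>i\<le>?N. (?N choose i) * card I ^ i)"
    by (intro sum_mono) (simp add: Suc_leI)
  also have "\<dots> = (card I + 1) ^ ?N"
    using binomial_ring[of "card I" 1 ?N] by (simp add: mult_ac)
  finally show ?thesis .
qed

text \<open>A word has at most one prefix of a given sum, because \<open>\<alpha>\<close> is positive on all letters.
  Hence concatenation is injective.\<close>
lemma card_words_mult_le:
  assumes "S \<subseteq> I"
  shows "card (words S X x) * card (words S X y) \<le> card (words S X (x + y))"
proof -
  have prefix: "u = u' \<and> v = v'"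
    if "u @ v = u' @ v'" "set u \<subseteq> I" "set u' \<subseteq> I" "sum_list (map X u) = sum_list (map X u')"
    for u v u' v' :: "nat list"
  proof -
    obtain t where t: "u = u' @ t \<and> t @ v = v' \<or> u @ t = u' \<and> v = t @ v'"
      using \<open>u @ v = u' @ v'\<close> by (auto simp: append_eq_append_conv2)
    then have "sum_list (map X t) = 0" "set t \<subseteq> I" using that by auto
    then have "t = []" using length_le_inner[of t] \<delta>_pos by (simp add: mult_le_0_iff)
    then show ?thesis using t by auto
  qed
  have "inj_on (\<lambda>(u, v). u @ v) (words S X x \<times> words S X y)"
  proof (rule inj_onI, clarify)
    fix u v u' v'
    assume "u \<in> words S X x" "u' \<in> words S X x" "u @ v = u' @ v'"
    then show "u = u' \<and> v = v'" using assms by (intro prefix) (auto simp: words_def)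
  qed
  moreover have "(\<lambda>(u, v). u @ v) ` (words S X x \<times> words S X y) \<subseteq> words S X (x + y)"
    by (auto simp: words_def)
  ultimately have "card (words S X x \<times> words S X y) \<le> card (words S X (x + y))"
    using finite_words[OF assms] by (rule card_inj_on_le)
  then show ?thesis by (simp add: card_cartesian_product)
qed

lemma card_words_pos_iff: "S \<subseteq> I \<Longrightarrow> card (words S X x) > 0 \<longleftrightarrow> words S X x \<noteq> {}"
  using finite_words[of S x] by (simp add: card_gt_0_iff)

lemma card_words_add_ge:
  assumes "S \<subseteq> I" "words S X y \<noteq> {}"
  shows "card (words S X x) \<le> card (words S X (x + y))"
proof -
  have "card (words S X x) * 1 \<le> card (words S X x) * card (words S X y)"
    using assms card_words_pos_iff[of S y] by (intro mult_left_mono) auto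
  also have "\<dots> \<le> card (words S X (x + y))" by (rule card_words_mult_le[OF assms(1)])
  finally show ?thesis by simp
qed

text \<open>The inequality of Fekete's argument: supermultiplicativity is iterated, and the
  remainder \<open>r\<close> enters through the base case, where its count is at least 1.\<close>

lemma card_words_power_le:
  assumes "S \<subseteq> I" "words S X r \<noteq> {}"
  shows "card (words S X x) ^ q \<le> card (words S X (real q *\<^sub>R x + r))"
proof (induction q)
  case 0
  then show ?case using assms card_words_pos_iff[of S r] by simp
next
  case (Suc q)
  have "card (words S X x) ^ Suc q \<le> card (words S X x) * card (words S X (real q *\<^sub>R x + r))"
    using Suc by simp
  also have "\<dots> \<le> card (words S X (x + (real q *\<^sub>R x + r)))"
    by (rule card_words_mult_le[OF assms(1)])
  also have "x + (real q *\<^sub>R x + r) = real (Suc q) *\<^sub>R x + r"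
    by (simp add: algebra_simps)
  finally show ?case .
qed

text \<open>Removing the letters outside \<open>S\<close> from a word loses only their positions.\<close>
lemma card_words_le_restrict:
  assumes "S \<subseteq> I" and "words I X z \<noteq> {}"
    and few: "\<forall>w\<in>words I X z. length (filter (\<lambda>j. j \<notin> S) w) \<le> B"
  obtains u where "set u \<subseteq> I" "length u \<le> B" "words S X (z - sum_list (map X u)) \<noteq> {}"
    "card (words I X z) \<le>
      (card I + 1) ^ B * (nat \<lfloor>(z \<bullet> \<alpha>) / \<delta>\<rfloor> + 1) ^ B * card (words S X (z - sum_list (map X u)))"
proof -
  \<comment> \<open>\<open>U\<close> holds the possible words of deleted letters, \<open>A u\<close>
    the words that can remain once \<open>u\<close> is deleted. \<open>N\<close> bounds the length
    of a word; the added 1 makes powers of \<open>N\<close> monotone in the exponent.\<close>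
  define U where "U = {u. set u \<subseteq> I - S \<and> length u \<le> B}"
  define A where "A u = words S X (z - sum_list (map X u))" for u
  define N where "N = nat \<lfloor>(z \<bullet> \<alpha>) / \<delta>\<rfloor> + 1"
  have fin_U: "finite U" unfolding U_def using finite_I by (intro finite_lists_length_le) auto
  have U_ne: "U \<noteq> {}" by (auto simp: U_def intro!: exI[of _ "[]"])
  have fin_A: "finite (A u)" for u unfolding A_def using assms by (intro finite_words) auto
  have split: "filter (\<lambda>j. j \<notin> S) w \<in> U \<and> filter (\<lambda>j. j \<in> S) w \<in> A (filter (\<lambda>j. j \<notin> S) w)"
    if w: "w \<in> words I X z" for w
    using filter_in_words[OF w] few w by (auto simp: U_def A_def words_def)
  have sh: "w \<in> shuffles (filter (\<lambda>j. j \<notin> S) w) (filter (\<lambda>j. j \<in> S) w)" for w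
    using partition_in_shuffles[of w "\<lambda>j. j \<notin> S"] by simp
  \<comment> \<open>A word is a shuffle of its deleted and its remaining part, so \<open>T p\<close>
    collects all words with the two parts \<open>p\<close>.\<close>
  define T where "T p = shuffles (fst p) (snd p) \<inter> words I X z" for p :: "nat list \<times> nat list"
  have sub: "words I X z \<subseteq> (\<Union>p\<in>Sigma U A. T p)"
  proof
    fix w assume w: "w \<in> words I X z"
    let ?p = "(filter (\<lambda>j. j \<notin> S) w, filter (\<lambda>j. j \<in> S) w)"
    have "?p \<in> Sigma U A" "w \<in> T ?p" using split[OF w] sh[of w] w by (auto simp: T_def)
    then show "w \<in> (\<Union>p\<in>Sigma U A. T p)" by blast
  qed
  have card_T: "card (T p) \<le> N ^ B" if p: "p \<in> Sigma U A" for p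
  proof (cases "T p = {}")
    case False
    then obtain w where w: "w \<in> shuffles (fst p) (snd p)" "w \<in> words I X z" by (auto simp: T_def)
    have len: "length (fst p) + length (snd p) \<le> N"
      using words_length_bound[OF w(2)] length_shuffles[OF w(1)] by (simp add: N_def)
    have disj: "set (fst p) \<inter> set (snd p) = {}" using p by (force simp: U_def A_def words_def)
    have "card (T p) \<le> card (shuffles (fst p) (snd p))"
      unfolding T_def by (intro card_mono) auto
    also have "\<dots> = (length (fst p) + length (snd p)) choose length (fst p)"
      by (rule card_disjoint_shuffles[OF disj])
    also have "\<dots> \<le> (length (fst p) + length (snd p)) ^ length (fst p)"
      by (rule binomial_le_pow) simp
    also have "\<dots> \<le> N ^ length (fst p)" using len by (rule power_mono) simp
    also have "\<dots> \<le> N ^ B" using p by (intro power_increasing) (auto simp: U_def N_def)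
    finally show ?thesis .
  qed (simp add: N_def)
  have fin_Sig: "finite (Sigma U A)" using fin_U fin_A by auto
  \<comment> \<open>Pigeonhole: the sum over all \<open>u\<close> in \<open>U\<close> is at most
    \<open>card U\<close> times its largest term.\<close>
  obtain u where u: "u \<in> U" and u_max: "\<And>v. v \<in> U \<Longrightarrow> card (A v) \<le> card (A u)"
  proof -
    have "Max ((\<lambda>v. card (A v)) ` U) \<in> (\<lambda>v. card (A v)) ` U" using fin_U U_ne by simp
    then obtain u where "u \<in> U" "Max ((\<lambda>v. card (A v)) ` U) = card (A u)" by auto
    then show ?thesis using that fin_U by (metis Max_ge finite_imageI image_eqI)
  qed
  have card_U: "card U \<le> (card I + 1) ^ B"
  proof -
    have "card U = (\<Sum>i\<le>B. card (I - S) ^ i)"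
      unfolding U_def using finite_I by (intro card_lists_length_le) auto
    also have "\<dots> \<le> (\<Sum>i\<le>B. (B choose i) * card I ^ i)"
    proof (intro sum_mono)
      fix i assume "i \<in> {..B}"
      then have "1 * card (I - S) ^ i \<le> (B choose i) * card I ^ i"
        using finite_I by (intro mult_mono power_mono card_mono) (auto simp: Suc_leI)
      then show "card (I - S) ^ i \<le> (B choose i) * card I ^ i" by simp
    qed
    also have "\<dots> = (card I + 1) ^ B" using binomial_ring[of "card I" 1 B] by (simp add: mult_ac)
    finally show ?thesis .
  qed
  have "card (words I X z) \<le> card (\<Union>p\<in>Sigma U A. T p)"
    using sub fin_Sig finite_words[of I z] by (intro card_mono) (auto simp: T_def)
  also have "\<dots> \<le> (\<Sum>p\<in>Sigma U A. card (T p))" by (rule card_UN_le[OF fin_Sig])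
  also have "\<dots> \<le> (\<Sum>p\<in>Sigma U A. N ^ B)" using card_T by (rule sum_mono)
  also have "\<dots> = (\<Sum>v\<in>U. card (A v)) * N ^ B" using fin_U fin_A by (simp add: card_SigmaI)
  also have "\<dots> \<le> (card U * card (A u)) * N ^ B"
    using sum_bounded_above[of U "\<lambda>v. card (A v)" "card (A u)"] u_max by simp
  also have "\<dots> \<le> ((card I + 1) ^ B * card (A u)) * N ^ B"
    using card_U by (intro mult_right_mono) auto
  finally have le: "card (words I X z) \<le> (card I + 1) ^ B * N ^ B * card (A u)"
    by (simp add: mult_ac)
  then have "A u \<noteq> {}" using assms(2) card_words_pos_iff[of I z] by auto
  then show ?thesis using that[of u] u le unfolding U_def A_def N_def by blast
qed

end

section \<open>The minimal face of a direction\<close>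

text \<open>A letter \<open>j\<close> not taking part in any representation of \<open>\<theta>\<close> is detected by a supporting
  functional of the cone that vanishes at \<open>\<theta>\<close>: otherwise \<open>- X j\<close> would lie in the (closed)
  cone generated by \<open>- \<theta>\<close> and all the vectors.\<close>
lemma supporting_functional:
  fixes X :: "nat \<Rightarrow> 'a::euclidean_space"
  assumes "finite I" and j: "j \<in> I"
    and pos: "\<forall>i\<in>I. X i \<bullet> \<alpha> > 0"
    and \<theta>: "\<theta> = (\<Sum>i\<in>I. c i *\<^sub>R X i)" "\<forall>i\<in>I. c i \<ge> 0"
    and not_used: "\<forall>d. (\<forall>i\<in>I. d i \<ge> 0) \<and> \<theta> = (\<Sum>i\<in>I. d i *\<^sub>R X i) \<longrightarrow> d j = 0"
  obtains a where "\<forall>i\<in>I. a \<bullet> X i \<ge> 0" "a \<bullet> \<theta> = 0" "a \<bullet> X j > 0"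
proof -
  \<comment> \<open>\<open>K\<close> is finitely generated, hence closed, which permits separation;
    the inclusion \<open>K \<subseteq> T\<close> provides explicit coefficients for its
    members.\<close>
  define K where "K = convex_cone hull (insert (- \<theta>) (X ` I))"
  define T where "T = {(\<Sum>i\<in>I. d i *\<^sub>R X i) - t *\<^sub>R \<theta> | d t. (\<forall>i\<in>I. d i \<ge> 0) \<and> t \<ge> 0}"
  have "convex_cone T"
    unfolding convex_cone_iff
  proof (intro conjI ballI allI impI)
    show "0 \<in> T" by (auto simp: T_def intro!: exI[of _ "\<lambda>_. 0"] exI[of _ 0])
  next
    fix x y assume "x \<in> T" "y \<in> T"
    then obtain d t d' t' where
      "x = (\<Sum>i\<in>I. d i *\<^sub>R X i) - t *\<^sub>R \<theta>" "\<forall>i\<in>I. d i \<ge> 0" "t \<ge> 0"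
      "y = (\<Sum>i\<in>I. d' i *\<^sub>R X i) - t' *\<^sub>R \<theta>" "\<forall>i\<in>I. d' i \<ge> 0" "t' \<ge> 0"
      by (auto simp: T_def)
    moreover from this have "x + y = (\<Sum>i\<in>I. (d i + d' i) *\<^sub>R X i) - (t + t') *\<^sub>R \<theta>"
      by (simp add: scaleR_add_left sum.distrib)
    ultimately show "x + y \<in> T"
      unfolding T_def by (intro CollectI exI[of _ "\<lambda>i. d i + d' i"] exI[of _ "t + t'"]) auto
  next
    fix x and r :: real assume "x \<in> T" "0 \<le> r"
    then obtain d t where "x = (\<Sum>i\<in>I. d i *\<^sub>R X i) - t *\<^sub>R \<theta>" "\<forall>i\<in>I. d i \<ge> 0" "t \<ge> 0"
      by (auto simp: T_def)
    moreover from this have "r *\<^sub>R x = (\<Sum>i\<in>I. (r * d i) *\<^sub>R X i) - (r * t) *\<^sub>R \<theta>"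
      by (simp add: scaleR_diff_right scaleR_sum_right)
    ultimately show "r *\<^sub>R x \<in> T"
      unfolding T_def using \<open>0 \<le> r\<close>
      by (intro CollectI exI[of _ "\<lambda>i. r * d i"] exI[of _ "r * t"]) auto
  qed
  moreover have "insert (- \<theta>) (X ` I) \<subseteq> T"
  proof -
    have "- \<theta> \<in> T" by (auto simp: T_def intro!: exI[of _ "\<lambda>_. 0"] exI[of _ 1])
    moreover have "X i \<in> T" if "i \<in> I" for i
      unfolding T_def
      using that \<open>finite I\<close>
      by (auto simp: if_distrib[of "\<lambda>r. r *\<^sub>R _"] cong: if_cong intro!: exI[of _ "\<lambda>l. if l = i then 1 else 0"] exI[of _ 0])
    ultimately show ?thesis by auto
  qed
  ultimately have "K \<subseteq> T" unfolding K_def by (intro hull_minimal)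
  have "- X j \<notin> K"
  proof
    assume "- X j \<in> K"
    then obtain d t where d: "- X j = (\<Sum>i\<in>I. d i *\<^sub>R X i) - t *\<^sub>R \<theta>" "\<forall>i\<in>I. d i \<ge> 0" "t \<ge> 0"
      using \<open>K \<subseteq> T\<close> by (auto simp: T_def)
    \<comment> \<open>Moving \<open>- X j\<close> to the other side raises the coefficient of
      \<open>j\<close> by one, so \<open>e j\<close> is at least 1.\<close>
    define e where "e i = d i + (if i = j then 1 else 0)" for i
    have e: "t *\<^sub>R \<theta> = (\<Sum>i\<in>I. e i *\<^sub>R X i)"
      using d(1) j \<open>finite I\<close>
      by (simp add: e_def scaleR_add_left sum.distrib if_distrib[of "\<lambda>r. r *\<^sub>R _"] algebra_simps cong: if_cong)
    have e_nonneg: "e i \<ge> 0" if "i \<in> I" for i using d that by (simp add: e_def)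
    \<comment> \<open>For \<open>t = 0\<close> a nonnegative combination with a positive coefficient
      would vanish, although \<alpha> is positive on every letter.\<close>
    have "t \<noteq> 0"
    proof
      assume "t = 0"
      then have "0 = (\<Sum>i\<in>I. e i * (X i \<bullet> \<alpha>))"
        using arg_cong[OF e, of "\<lambda>x. x \<bullet> \<alpha>"] by (simp add: inner_sum_left)
      moreover have "(\<Sum>i\<in>I. e i * (X i \<bullet> \<alpha>)) > 0"
        using d j pos \<open>finite I\<close> e_nonneg
        by (intro sum_pos2[of _ j]) (auto simp: e_def less_imp_le add_nonneg_pos intro!: mult_nonneg_nonneg mult_pos_pos)
      ultimately show False by simp
    qed
    then have "\<theta> = (\<Sum>i\<in>I. (e i / t) *\<^sub>R X i)"
      using arg_cong[OF e, of "\<lambda>x. (1 / t) *\<^sub>R x"] by (simp add: scaleR_sum_right)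
    moreover have "\<forall>i\<in>I. e i / t \<ge> 0" using e_nonneg d by simp
    ultimately have "e j / t = 0" using not_used[rule_format, of "\<lambda>i. e i / t"] by blast
    then show False using \<open>t \<noteq> 0\<close> d j by (auto simp: e_def add_nonneg_eq_0_iff)
  qed
  moreover have "closed K" unfolding K_def using \<open>finite I\<close> by (intro closed_convex_cone_hull) auto
  moreover have "convex K" unfolding K_def by (rule convex_convex_cone_hull)
  ultimately obtain a b where a: "a \<bullet> (- X j) < b" "\<forall>x\<in>K. a \<bullet> x > b"
    using separating_hyperplane_closed_point by blast
  have "0 \<in> K" unfolding K_def by (rule convex_cone_hull_contains_0)
  then have "b < 0" using a by force
  \<comment> \<open>A point of the cone with negative value could be rescaled to have value exactly
    \<open>b\<close>, against strict separation.\<close>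
  have nonneg: "a \<bullet> x \<ge> 0" if "x \<in> K" for x
  proof (rule ccontr)
    assume neg: "\<not> a \<bullet> x \<ge> 0"
    then have "(b / (a \<bullet> x)) *\<^sub>R x \<in> K"
      using that \<open>b < 0\<close> unfolding K_def by (intro convex_cone_hull_mul) (auto simp: divide_nonpos_neg)
    then show False using a(2) neg by force
  qed
  have X_nonneg: "a \<bullet> X i \<ge> 0" if "i \<in> I" for i
    using that by (intro nonneg) (auto simp: K_def hull_inc)
  have "a \<bullet> (- \<theta>) \<ge> 0" by (intro nonneg) (auto simp: K_def hull_inc)
  moreover have "a \<bullet> \<theta> \<ge> 0"
    unfolding \<theta>(1) using X_nonneg \<theta>(2) by (auto simp: inner_sum_right intro!: sum_nonneg)
  ultimately have "a \<bullet> \<theta> = 0" by simp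
  then show ?thesis using that X_nonneg a(1) \<open>b < 0\<close> by force
qed

text \<open>\<open>S\<close> consists of the letters in the minimal face of the cone containing \<open>\<theta>\<close>.\<close>
lemma minimal_face:
  fixes X :: "nat \<Rightarrow> 'a::euclidean_space"
  assumes "finite I"
    and pos: "\<forall>i\<in>I. X i \<bullet> \<alpha> > 0"
    and c: "\<theta> = (\<Sum>i\<in>I. c i *\<^sub>R X i)" "\<forall>i\<in>I. c i \<ge> 0"
  obtains S d a where "S \<subseteq> I" "\<forall>i\<in>S. d i > 0" "\<theta> = (\<Sum>i\<in>S. d i *\<^sub>R X i)"
    "a \<bullet> \<theta> = 0" "\<forall>i\<in>I. a \<bullet> X i \<ge> 0" "\<forall>i\<in>I - S. a \<bullet> X i > 0"
proof -
  define P where "P d \<longleftrightarrow> (\<forall>i\<in>I. d i \<ge> 0) \<and> \<theta> = (\<Sum>i\<in>I. d i *\<^sub>R X i)" for d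
  define S where "S = {j\<in>I. \<exists>d. P d \<and> d j > 0}"
  have "finite S" using \<open>finite I\<close> by (simp add: S_def)
  \<comment> \<open>Averages of representations are representations. Averaging one that is positive
    at \<open>j\<close> for each \<open>j\<close> in \<open>S\<close> gives one positive on all of
    \<open>S\<close>.\<close>
  have P_sum: "P (\<lambda>i. (\<Sum>j\<in>A. D j i) / real (card A))"
    if "finite A" "A \<noteq> {}" and D: "\<And>j. j \<in> A \<Longrightarrow> P (D j)" for A :: "nat set" and D
  proof -
    have "(\<Sum>i\<in>I. ((\<Sum>j\<in>A. D j i) / real (card A)) *\<^sub>R X i)
        = (1 / real (card A)) *\<^sub>R (\<Sum>i\<in>I. \<Sum>j\<in>A. D j i *\<^sub>R X i)"
      by (simp add: scaleR_sum_right scaleR_sum_left sum_divide_distrib)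
    also have "(\<Sum>i\<in>I. \<Sum>j\<in>A. D j i *\<^sub>R X i) = (\<Sum>j\<in>A. \<Sum>i\<in>I. D j i *\<^sub>R X i)"
      by (rule sum.swap)
    also have "\<dots> = (\<Sum>j\<in>A. \<theta>)" using D by (intro sum.cong) (auto simp: P_def)
    finally show ?thesis
      using that by (auto simp: P_def sum_constant_scaleR intro!: divide_nonneg_nonneg sum_nonneg)
  qed
  have "\<exists>d. P d \<and> (\<forall>i\<in>S. d i > 0)"
  proof (cases "S = {}")
    case True
    then show ?thesis using c by (auto simp: P_def)
  next
    case False
    obtain D where D: "\<And>j. j \<in> S \<Longrightarrow> P (D j) \<and> D j j > 0"
      by atomize_elim (rule choice, auto simp: S_def)
    have "(\<Sum>j\<in>S. D j i) / real (card S) > 0" if "i \<in> S" for i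
    proof -
      have "(\<Sum>j\<in>S. D j i) > 0"
        using D that \<open>finite S\<close> by (intro sum_pos2[of _ i]) (auto simp: P_def S_def)
      then show ?thesis using False \<open>finite S\<close> by (simp add: card_gt_0_iff)
    qed
    then show ?thesis using P_sum[OF \<open>finite S\<close> False] D by blast
  qed
  then obtain d where d: "P d" "\<And>i. i \<in> S \<Longrightarrow> d i > 0" by auto
  have zero: "e i = 0" if "P e" "i \<in> I - S" for e i
  proof -
    have "e i \<ge> 0" "\<not> e i > 0" using that by (auto simp: P_def S_def)
    then show ?thesis by simp
  qed
  have "\<theta> = (\<Sum>i\<in>I. d i *\<^sub>R X i)" using d by (simp add: P_def)
  also have "\<dots> = (\<Sum>i\<in>S. d i *\<^sub>R X i)"
    using \<open>finite I\<close> zero[OF d(1)] by (intro sum.mono_neutral_right) (auto simp: S_def)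
  finally have \<theta>: "\<theta> = (\<Sum>i\<in>S. d i *\<^sub>R X i)" .
  have "\<exists>a. (\<forall>i\<in>I. a \<bullet> X i \<ge> 0) \<and> a \<bullet> \<theta> = 0 \<and> a \<bullet> X j > 0" if "j \<in> I - S" for j
  proof -
    have "j \<in> I" using that by simp
    moreover have "\<forall>d. (\<forall>i\<in>I. d i \<ge> 0) \<and> \<theta> = (\<Sum>i\<in>I. d i *\<^sub>R X i) \<longrightarrow> d j = 0"
      using zero that unfolding P_def by blast
    ultimately obtain a where "\<forall>i\<in>I. a \<bullet> X i \<ge> 0" "a \<bullet> \<theta> = 0" "a \<bullet> X j > 0"
      using supporting_functional[OF \<open>finite I\<close> _ pos c] by blast
    then show ?thesis by blast
  qed
  then obtain a where a: "\<And>j. j \<in> I - S \<Longrightarrow> (\<forall>i\<in>I. a j \<bullet> X i \<ge> 0) \<and> a j \<bullet> \<theta> = 0 \<and> a j \<bullet> X j > 0"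
    by metis
  \<comment> \<open>Each summand is nonnegative on all letters, and the one with index
    \<open>i\<close> is positive at \<open>X i\<close>, so a single functional detects all letters
    outside \<open>S\<close>.\<close>
  define b where "b = (\<Sum>j\<in>I - S. a j)"
  have "b \<bullet> \<theta> = 0" using a by (simp add: b_def inner_sum_left)
  moreover have "b \<bullet> X i \<ge> 0" if "i \<in> I" for i
    using a that by (auto simp: b_def inner_sum_left intro!: sum_nonneg)
  moreover have "b \<bullet> X i > 0" if "i \<in> I - S" for i
    unfolding b_def inner_sum_left using a that \<open>finite I\<close> by (intro sum_pos2[of _ i]) auto
  ultimately show ?thesis using that[of S d b] d \<theta> by (auto simp: S_def)
qed

section \<open>Integer combinations\<close>

text \<open>Serves twice: for the finiteness of bounded sets of integer vectors and for the
  closedness of the semigroup.\<close>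

lemma uniform_discrete_integral_vectors:
  "uniform_discrete {x :: real ^ 's. \<forall>i. x $ i \<in> \<int>}"
  unfolding uniform_discrete_def
proof (intro exI[of _ 1] conjI ballI impI)
  fix x y :: "real ^ 's"
  assume x: "x \<in> {x. \<forall>i. x $ i \<in> \<int>}" and y: "y \<in> {x. \<forall>i. x $ i \<in> \<int>}" and "dist x y < 1"
  have "x $ i = y $ i" for i
  proof -
    have "\<bar>x $ i - y $ i\<bar> < 1"
      using component_le_norm_cart[of "x - y" i] \<open>dist x y < 1\<close> by (simp add: dist_norm)
    moreover have "x $ i - y $ i \<in> \<int>" using x y by auto
    ultimately show ?thesis using Ints_nonzero_abs_less1 by fastforce
  qed
  then show "x = y" by (simp add: vec_eq_iff)
qed simp

text \<open>Coordinates with respect to a basis chosen among the vectors are linear functionals,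
  hence bounded in finite dimension; all other coefficients are set to zero.\<close>

lemma span_bounded_coefficients:
  fixes X :: "nat \<Rightarrow> 'a::euclidean_space"
  assumes "finite S"
  obtains K where "K \<ge> 0"
    "\<And>w. w \<in> span (X ` S) \<Longrightarrow> \<exists>y. w = (\<Sum>j\<in>S. y j *\<^sub>R X j) \<and> (\<forall>j. \<bar>y j\<bar> \<le> K * norm w)"
proof -
  obtain B where B: "B \<subseteq> X ` S" "independent B" "X ` S \<subseteq> span B"
    using maximal_independent_subset by blast
  \<comment> \<open>Different letters may carry the same vector, so the basis is indexed by a set
    \<open>T\<close> on which \<open>X\<close> is injective.\<close>
  obtain T where T: "T \<subseteq> S" "inj_on X T" "B = X ` T"
    using B(1) by (auto simp: subset_image_inj)
  have "finite T" using T assms finite_subset by blast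
  have "\<exists>g. linear g \<and> (\<forall>x\<in>B. g x = (if x = X j then 1 else 0 :: real))" for j
    using B(2) by (rule linear_independent_extend)
  then obtain g where g: "\<And>j. linear (g j)" "\<And>j x. x \<in> B \<Longrightarrow> g j x = (if x = X j then 1 else 0 :: real)"
    by metis
  have "\<exists>K>0. \<forall>w. \<bar>g j w\<bar> \<le> K * norm w" for j
    using linear_bounded_pos[OF g(1)[of j]] by (metis real_norm_def)
  then obtain K where K: "\<And>j. K j > 0" "\<And>j w. \<bar>g j w\<bar> \<le> K j * norm w" by metis
  define y where "y w j = (if j \<in> T then g j w else 0)" for w j
  have "\<bar>y w j\<bar> \<le> (\<Sum>i\<in>T. K i) * norm w" for w j
  proof (cases "j \<in> T")
    case True
    have "\<bar>y w j\<bar> \<le> K j * norm w" using True K by (simp add: y_def)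
    also have "\<dots> \<le> (\<Sum>i\<in>T. K i) * norm w"
      using True K(1) \<open>finite T\<close> by (intro mult_right_mono member_le_sum) (auto simp: less_imp_le)
    finally show ?thesis .
  next
    case False
    then show ?thesis using K(1) by (auto simp: y_def less_imp_le intro!: mult_nonneg_nonneg sum_nonneg)
  qed
  moreover have "w = (\<Sum>j\<in>S. y w j *\<^sub>R X j)" if "w \<in> span (X ` S)" for w
  proof -
    have w: "w \<in> span B" using that B(3) by (metis span_minimal subset_iff subspace_span)
    have lin: "linear (\<lambda>w. \<Sum>j\<in>T. g j w *\<^sub>R X j)"
      using g(1) by (auto simp: linear_iff algebra_simps sum.distrib scaleR_sum_right intro!: linear_compose_sum)
    have basis: "b = (\<Sum>j\<in>T. g j b *\<^sub>R X j)" if "b \<in> B" for b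
    proof -
      obtain i where i: "i \<in> T" "b = X i" using \<open>b \<in> B\<close> T(3) by blast
      have "(\<Sum>j\<in>T. g j b *\<^sub>R X j) = (\<Sum>j\<in>T. if j = i then X j else 0)"
        using i T g(2)[OF that] by (intro sum.cong) (auto simp: inj_on_def)
      then show ?thesis using i \<open>finite T\<close> by simp
    qed
    have "w = (\<Sum>j\<in>T. g j w *\<^sub>R X j)" by (rule linear_eq_on[OF linear_ident lin w basis])
    also have "\<dots> = (\<Sum>j\<in>S. y w j *\<^sub>R X j)"
      using T(1) assms by (intro sum.mono_neutral_cong_left) (auto simp: y_def)
    finally show ?thesis .
  qed
  ultimately show ?thesis
    using K(1) by (intro that[of "\<Sum>i\<in>T. K i"]) (auto simp: less_imp_le intro!: sum_nonneg)
qed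

lemma norm_floor_combination_le:
  fixes X :: "nat \<Rightarrow> 'a::euclidean_space"
  shows "norm ((\<Sum>j\<in>S. y j *\<^sub>R X j) - (\<Sum>j\<in>S. real_of_int \<lfloor>y j\<rfloor> *\<^sub>R X j)) \<le> (\<Sum>j\<in>S. norm (X j))"
proof -
  have "(\<Sum>j\<in>S. y j *\<^sub>R X j) - (\<Sum>j\<in>S. real_of_int \<lfloor>y j\<rfloor> *\<^sub>R X j) = (\<Sum>j\<in>S. frac (y j) *\<^sub>R X j)"
    by (simp add: frac_def algebra_simps sum_subtractf)
  also have "norm \<dots> \<le> (\<Sum>j\<in>S. norm (X j))"
    by (intro sum_norm_le) (auto simp: mult_left_le_one_le less_imp_le frac_lt_1)
  finally show ?thesis .
qed

text \<open>Rounding a real representation leaves one of finitely many lattice points.\<close>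
lemma integer_combination_bounded_coefficients:
  fixes X :: "nat \<Rightarrow> real ^ 's"
  assumes "finite S" and int: "\<forall>j\<in>S. \<forall>i. X j $ i \<in> \<int>"
  obtains K where "K \<ge> 0"
    "\<forall>w. (\<exists>n :: nat \<Rightarrow> int. w = (\<Sum>j\<in>S. real_of_int (n j) *\<^sub>R X j)) \<longrightarrow>
      (\<exists>n :: nat \<Rightarrow> int. w = (\<Sum>j\<in>S. real_of_int (n j) *\<^sub>R X j) \<and>
        (\<forall>j\<in>S. \<bar>real_of_int (n j)\<bar> \<le> K * (1 + norm w)))"
proof -
  obtain K where K: "K \<ge> 0"
    "\<And>w. w \<in> span (X ` S) \<Longrightarrow> \<exists>y. w = (\<Sum>j\<in>S. y j *\<^sub>R X j) \<and> (\<forall>j. \<bar>y j\<bar> \<le> K * norm w)"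
    using span_bounded_coefficients[OF \<open>finite S\<close>] by blast
  define comb where "comb n = (\<Sum>j\<in>S. real_of_int (n j) *\<^sub>R X j)" for n :: "nat \<Rightarrow> int"
  define E where "E = (\<Sum>j\<in>S. norm (X j))"
  define G where "G = range comb \<inter> cball 0 E"
  have "finite G"
  proof -
    have "G \<subseteq> {x. \<forall>i. x $ i \<in> \<int>}" using int by (auto simp: G_def comb_def intro!: Ints_sum)
    then have "uniform_discrete G" using uniform_discrete_integral_vectors by (rule uniform_discrete_subset[rotated])
    moreover have "bounded G" by (simp add: G_def bounded_Int)
    ultimately show ?thesis using uniform_discrete_finite_iff by blast
  qed
  have "\<exists>n. comb n = x" if "x \<in> G" for x using that by (auto simp: G_def)
  \<comment> \<open>\<open>G\<close> contains every remainder that rounding can leave. Fixing one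
    integer representation for each of its finitely many points bounds all their coefficients by
    \<open>M\<close>.\<close>
  then obtain rep where rep: "\<And>x. x \<in> G \<Longrightarrow> comb (rep x) = x" by metis
  define M where "M = (\<Sum>x\<in>G. \<Sum>j\<in>S. \<bar>real_of_int (rep x j)\<bar>)"
  have M: "\<bar>real_of_int (rep x j)\<bar> \<le> M" if "x \<in> G" "j \<in> S" for x j
  proof -
    have "\<bar>real_of_int (rep x j)\<bar> \<le> (\<Sum>j\<in>S. \<bar>real_of_int (rep x j)\<bar>)"
      using that \<open>finite S\<close> by (intro member_le_sum) auto
    also have "\<dots> \<le> M"
      unfolding M_def using that \<open>finite G\<close>
      by (intro member_le_sum[of _ _ "\<lambda>x. \<Sum>j\<in>S. \<bar>real_of_int (rep x j)\<bar>"]) (auto intro!: sum_nonneg)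
    finally show ?thesis .
  qed
  have "M \<ge> 0" by (auto simp: M_def intro!: sum_nonneg)
  show ?thesis
  proof (rule that[of "K + M + 1"], goal_cases)
    case 1
    show ?case using K \<open>M \<ge> 0\<close> by simp
  next
    case 2
    show ?case
    proof (intro allI impI)
      fix w
      assume "\<exists>n :: nat \<Rightarrow> int. w = (\<Sum>j\<in>S. real_of_int (n j) *\<^sub>R X j)"
      then obtain n :: "nat \<Rightarrow> int" where w: "w = (\<Sum>j\<in>S. real_of_int (n j) *\<^sub>R X j)" by blast
      have "w \<in> span (X ` S)" unfolding w by (intro span_sum span_scale span_base) auto
      then obtain y where y: "w = (\<Sum>j\<in>S. y j *\<^sub>R X j)" "\<And>j. \<bar>y j\<bar> \<le> K * norm w"
        using K(2) by blast
      \<comment> \<open>\<open>x\<close> is small and, like \<open>w\<close>, an integer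
        combination. The uncontrolled coefficients \<open>n\<close> are thus traded for the rounded
        \<open>y\<close> plus those of a fixed representation.\<close>
      define x where "x = w - comb (\<lambda>j. \<lfloor>y j\<rfloor>)"
      have "norm x \<le> E"
        unfolding x_def E_def comb_def y(1) by (rule norm_floor_combination_le)
      moreover have "x = comb (\<lambda>j. n j - \<lfloor>y j\<rfloor>)"
        by (simp add: x_def w comb_def algebra_simps sum_subtractf)
      ultimately have "x \<in> G" by (auto simp: G_def)
      have "w = comb (\<lambda>j. \<lfloor>y j\<rfloor>) + comb (rep x)" using rep[OF \<open>x \<in> G\<close>] by (simp add: x_def)
      also have "\<dots> = comb (\<lambda>j. \<lfloor>y j\<rfloor> + rep x j)" by (simp add: comb_def algebra_simps sum.distrib)
      finally have "w = comb (\<lambda>j. \<lfloor>y j\<rfloor> + rep x j)" .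
      moreover have "\<bar>real_of_int (\<lfloor>y j\<rfloor> + rep x j)\<bar> \<le> (K + M + 1) * (1 + norm w)" if "j \<in> S" for j
      proof -
        have "\<bar>real_of_int (\<lfloor>y j\<rfloor> + rep x j)\<bar> \<le> (K * norm w + 1) + M"
          using y(2)[of j] M[OF \<open>x \<in> G\<close> that] by linarith
        also have "\<dots> \<le> (K + M + 1) * (1 + norm w)"
          using K(1) \<open>M \<ge> 0\<close> by (simp add: algebra_simps)
        finally show ?thesis .
      qed
      ultimately show "\<exists>n :: nat \<Rightarrow> int. w = (\<Sum>j\<in>S. real_of_int (n j) *\<^sub>R X j) \<and>
          (\<forall>j\<in>S. \<bar>real_of_int (n j)\<bar> \<le> (K + M + 1) * (1 + norm w))"
        unfolding comb_def by (intro exI[of _ "\<lambda>j. \<lfloor>y j\<rfloor> + rep x j"]) simp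
    qed
  qed
qed

section \<open>A convergence criterion of Fekete type\<close>

text \<open>Every late value is, up to \<open>e\<close>, an eventual lower bound, so the limit
  superior is at most the limit inferior.\<close>

lemma convergent_if_eventually_almost_above:
  fixes b :: "nat \<Rightarrow> real"
  assumes bdd: "\<And>k. \<bar>b k\<bar> \<le> C"
    and above: "\<And>e. e > 0 \<Longrightarrow> \<exists>K. \<forall>k0\<ge>K. \<exists>N. \<forall>k\<ge>N. b k \<ge> b k0 - e"
  shows "convergent b"
proof -
  \<comment> \<open>The supremum of \<open>A\<close> is the limit inferior of
    \<open>b\<close>.\<close>
  define A where "A = {a. \<exists>N. \<forall>k\<ge>N. a \<le> b k}"
  have A_le: "a \<le> C" if "a \<in> A" for a
    using that bdd unfolding A_def by (force simp: abs_le_iff intro: order_trans)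
  have "- C \<in> A" using bdd by (auto simp: A_def abs_le_iff) (metis minus_le_iff)
  define L where "L = Sup A"
  have bddA: "bdd_above A" using A_le by (rule bdd_aboveI)
  have "b \<longlonglongrightarrow> L"
  proof (rule LIMSEQ_I)
    fix r :: real assume "r > 0"
    obtain K where K: "\<forall>k0\<ge>K. \<exists>N. \<forall>k\<ge>N. b k \<ge> b k0 - r / 2" using above[of "r / 2"] \<open>r > 0\<close> by auto
    have up: "b k0 \<le> L + r / 2" if "k0 \<ge> K" for k0
    proof -
      have "b k0 - r / 2 \<in> A" using K that by (auto simp: A_def)
      then have "b k0 - r / 2 \<le> L" unfolding L_def using bddA by (rule cSup_upper)
      then show ?thesis by simp
    qed
    obtain a where "a \<in> A" "L - r < a"
      using less_cSup_iff[of A "L - r"] \<open>- C \<in> A\<close> bddA \<open>r > 0\<close> by (auto simp: L_def)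
    then obtain N where N: "\<forall>k\<ge>N. a \<le> b k" by (auto simp: A_def)
    have "norm (b k - L) < r" if "k \<ge> max K N" for k
      using up[of k] N that \<open>L - r < a\<close> \<open>r > 0\<close> by (force simp: abs_less_iff)
    then show "\<exists>no. \<forall>n\<ge>no. norm (b n - L) < r" by blast
  qed
  then show ?thesis by (auto simp: convergent_def)
qed

lemma finite_positive_lower_bound:
  fixes f :: "'b \<Rightarrow> real"
  assumes "finite A" "\<And>x. x \<in> A \<Longrightarrow> f x > 0"
  obtains e where "e > 0" "\<And>x. x \<in> A \<Longrightarrow> e \<le> f x"
  \<comment> \<open>The inserted 1 covers the case of an empty \<open>A\<close>.\<close>
  using assms by (intro that[of "Min (insert 1 (f ` A))"]) auto

text \<open>The functional \<open>a\<close> does not see multiples of \<theta>, so its value at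
  \<open>z\<close> is at most \<open>norm a * D\<close>; every letter outside \<open>S\<close>
  contributes a fixed positive amount and no letter contributes a negative one. Hence
  \<open>B\<close> is uniform in \<open>r\<close>.\<close>

lemma few_letters_outside_face:
  fixes X :: "nat \<Rightarrow> 'a::euclidean_space"
  assumes "finite I"
    and a: "a \<bullet> \<theta> = 0" "\<forall>i\<in>I. a \<bullet> X i \<ge> 0" "\<forall>i\<in>I - S. a \<bullet> X i > 0"
  obtains B where "\<forall>w r z. w \<in> words I X z \<and> norm (z - r *\<^sub>R \<theta>) \<le> D
    \<longrightarrow> length (filter (\<lambda>j. j \<notin> S) w) \<le> B"
proof -
  have "finite (I - S)" using assms(1) by simp
  then obtain e where e: "e > 0" "\<And>i. i \<in> I - S \<Longrightarrow> e \<le> a \<bullet> X i"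
    using finite_positive_lower_bound[of "I - S" "\<lambda>i. a \<bullet> X i"] a(3) by metis
  have len: "e * real (length (filter (\<lambda>j. j \<notin> S) w)) \<le> a \<bullet> sum_list (map X w)" if "set w \<subseteq> I" for w
    using that
  proof (induction w)
    case (Cons i w)
    then show ?case using e(2)[of i] a(2) by (auto simp: algebra_simps inner_add_right)
  qed simp
  show ?thesis
  proof (rule that, intro allI impI, elim conjE)
    fix w r z
    assume w: "w \<in> words I X z" and z: "norm (z - r *\<^sub>R \<theta>) \<le> D"
    have "e * real (length (filter (\<lambda>j. j \<notin> S) w)) \<le> a \<bullet> z" using len[of w] w by (auto simp: words_def)
    also have "\<dots> = a \<bullet> (z - r *\<^sub>R \<theta>)" using a(1) by (simp add: inner_diff_right)
    also have "\<dots> \<le> norm a * norm (z - r *\<^sub>R \<theta>)" by (rule norm_cauchy_schwarz)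
    also have "\<dots> \<le> norm a * D" using z by (rule mult_left_mono) simp
    finally have "real (length (filter (\<lambda>j. j \<notin> S) w)) \<le> norm a * D / e"
      using e(1) by (simp add: pos_le_divide_eq mult.commute)
    then show "length (filter (\<lambda>j. j \<notin> S) w) \<le> nat \<lfloor>norm a * D / e\<rfloor>" by (rule le_nat_floor)
  qed
qed

section \<open>Growth of the number of words\<close>

text \<open>The slack \<open>(k - q * k0) *\<^sub>R \<theta>\<close> is at least \<open>(e * k) *\<^sub>R \<theta>\<close>, hence lies deep inside the face,
  whereas the accumulated error \<open>q * D\<close> is at most \<open>k * D / k0\<close>; so for large \<open>k0\<close> the slack absorbs
  the error.\<close>
lemma absorb_multiples:
  fixes X :: "nat \<Rightarrow> real ^ 's"
  assumes "finite S" and int: "\<forall>j\<in>S. \<forall>i. X j $ i \<in> \<int>"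
    and d: "\<forall>j\<in>S. d j > 0" "\<theta> = (\<Sum>j\<in>S. d j *\<^sub>R X j)"
    and e: "0 < e" "e < 1"
  obtains K0 N :: nat where
    "\<forall>k0\<ge>K0. \<forall>k\<ge>N. \<forall>x z q.
       words S X x \<noteq> {} \<and> norm (x - real k0 *\<^sub>R \<theta>) \<le> D \<and>
       words S X z \<noteq> {} \<and> norm (z - real k *\<^sub>R \<theta>) \<le> D \<and> real q * real k0 \<le> (1 - e) * real k
     \<longrightarrow> words S X (z - real q *\<^sub>R x) \<noteq> {}"
proof -
  obtain K where K: "K \<ge> 0"
    "\<forall>w. (\<exists>n :: nat \<Rightarrow> int. w = (\<Sum>j\<in>S. real_of_int (n j) *\<^sub>R X j)) \<longrightarrow>
      (\<exists>n :: nat \<Rightarrow> int. w = (\<Sum>j\<in>S. real_of_int (n j) *\<^sub>R X j) \<and>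
        (\<forall>j\<in>S. \<bar>real_of_int (n j)\<bar> \<le> K * (1 + norm w)))"
    by (rule integer_combination_bounded_coefficients[OF \<open>finite S\<close> int])
  obtain p where p: "p > 0" "\<And>j. j \<in> S \<Longrightarrow> p \<le> d j"
    using finite_positive_lower_bound[of S d] \<open>finite S\<close> d(1) by metis
  define E where "E = (\<Sum>j\<in>S. norm (X j))"
  \<comment> \<open>With these thresholds the accumulated error of the copies of \<open>x\<close>
    and the constant errors each use at most half of \<open>e * p * k\<close>, a lower bound for the
    coefficients of the slack.\<close>
  define K0 where "K0 = nat \<lceil>2 * K * D / (e * p)\<rceil> + 1"
  define N where "N = nat \<lceil>2 * (K * (1 + D + E) + 1) / (e * p)\<rceil>"
  have ep: "e * p > 0" using e p by simp
  show ?thesis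
  proof (rule that, intro allI impI, elim conjE)
    fix k0 k q :: nat and x z
    assume k0: "k0 \<ge> K0" and x: "words S X x \<noteq> {}" "norm (x - real k0 *\<^sub>R \<theta>) \<le> D"
      and k: "k \<ge> N" and z: "words S X z \<noteq> {}" "norm (z - real k *\<^sub>R \<theta>) \<le> D"
      and q: "real q * real k0 \<le> (1 - e) * real k"
    obtain nx :: "nat \<Rightarrow> nat" where nx: "x = (\<Sum>j\<in>S. real (nx j) *\<^sub>R X j)"
      using x(1) words_nonempty_iff[OF \<open>finite S\<close>] by blast
    obtain nz :: "nat \<Rightarrow> nat" where nz: "z = (\<Sum>j\<in>S. real (nz j) *\<^sub>R X j)"
      using z(1) words_nonempty_iff[OF \<open>finite S\<close>] by blast
    define t where "t = real k - real q * real k0"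
    have t: "t \<ge> e * real k" using q by (simp add: t_def algebra_simps)
    \<comment> \<open>\<open>f\<close> is an integer point near \<open>t *\<^sub>R \<theta>\<close>,
      and \<open>w\<close> is what separates it from the remainder. The norm of \<open>w\<close>
      involves only the errors of \<open>z\<close>, of the copies of \<open>x\<close> and of
      rounding.\<close>
    define f where "f = (\<Sum>j\<in>S. real_of_int \<lfloor>t * d j\<rfloor> *\<^sub>R X j)"
    define w where "w = z - real q *\<^sub>R x - f"
    have "w = (\<Sum>j\<in>S. real_of_int (int (nz j) - int q * int (nx j) - \<lfloor>t * d j\<rfloor>) *\<^sub>R X j)"
      by (simp add: w_def f_def nx nz scaleR_sum_right scaleR_diff_left sum_subtractf)
    then have "\<exists>n :: nat \<Rightarrow> int. w = (\<Sum>j\<in>S. real_of_int (n j) *\<^sub>R X j)"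
      by (rule exI[of _ "\<lambda>j. int (nz j) - int q * int (nx j) - \<lfloor>t * d j\<rfloor>"])
    from K(2)[rule_format, OF this] obtain n :: "nat \<Rightarrow> int" where n: "w = (\<Sum>j\<in>S. real_of_int (n j) *\<^sub>R X j)"
      "\<forall>j\<in>S. \<bar>real_of_int (n j)\<bar> \<le> K * (1 + norm w)"
      by (elim exE conjE) (rule that)
    have f: "norm (t *\<^sub>R \<theta> - f) \<le> E"
      using norm_floor_combination_le[of "\<lambda>j. t * d j" X S]
      by (simp add: d(2) f_def E_def scaleR_sum_right)
    have "w = (z - real k *\<^sub>R \<theta>) - real q *\<^sub>R (x - real k0 *\<^sub>R \<theta>) + (t *\<^sub>R \<theta> - f)"
      by (simp add: w_def t_def algebra_simps)
    also have "norm \<dots> \<le> norm (z - real k *\<^sub>R \<theta>) + norm (real q *\<^sub>R (x - real k0 *\<^sub>R \<theta>)) + norm (t *\<^sub>R \<theta> - f)"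
      by (intro norm_triangle_le add_mono norm_triangle_ineq4 order_refl)
    also have "\<dots> \<le> D + real q * D + E"
      using x(2) z(2) f by (intro add_mono) (auto intro!: mult_left_mono)
    finally have w: "norm w \<le> D + real q * D + E" .
    have qD: "K * (real q * D) \<le> e * p * real k / 2"
    proof -
      have "2 * K * D / (e * p) \<le> real k0" using k0 unfolding K0_def by linarith
      then have "2 * K * D \<le> real k0 * (e * p)" using ep by (simp add: pos_divide_le_eq)
      then have "real q * (2 * K * D) \<le> real q * (real k0 * (e * p))" by (rule mult_left_mono) simp
      also have "\<dots> = (real q * real k0) * (e * p)" by simp
      also have "\<dots> \<le> real k * (e * p)"
      proof (rule mult_right_mono)
        have "(1 - e) * real k \<le> 1 * real k" using e by (intro mult_right_mono) auto
        then show "real q * real k0 \<le> real k" using q by linarith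
      qed (use ep in simp)
      finally show ?thesis by (simp add: algebra_simps)
    qed
    have kN: "K * (1 + D + E) + 1 \<le> e * p * real k / 2"
    proof -
      have "2 * (K * (1 + D + E) + 1) / (e * p) \<le> real k" using k unfolding N_def by linarith
      then have "2 * (K * (1 + D + E) + 1) \<le> real k * (e * p)" using ep by (simp add: pos_divide_le_eq)
      then show ?thesis by (simp add: algebra_simps)
    qed
    \<comment> \<open>The extra 1 in \<open>kN\<close> pays for the floor, which loses less than
      1.\<close>
    have "\<lfloor>t * d j\<rfloor> + n j \<ge> 0" if "j \<in> S" for j
    proof -
      have "\<bar>real_of_int (n j)\<bar> \<le> K * (1 + norm w)" using n(2) that by blast
      also have "\<dots> \<le> K * (1 + (D + real q * D + E))" using w K(1) by (intro mult_left_mono) auto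
      also have "\<dots> = K * (1 + D + E) + K * (real q * D)" by (simp add: algebra_simps)
      also have "\<dots> \<le> e * p * real k - 1" using qD kN by linarith
      finally have nj: "\<bar>real_of_int (n j)\<bar> \<le> e * p * real k - 1" .
      have "(e * real k) * p \<le> t * d j"
        using t p(1) p(2)[OF that] e by (intro mult_mono) (auto intro: order_trans[OF _ t])
      then have "e * p * real k \<le> t * d j" by (simp add: algebra_simps)
      then show ?thesis using nj by linarith
    qed
    then have "(\<Sum>j\<in>S. real (nat (\<lfloor>t * d j\<rfloor> + n j)) *\<^sub>R X j) = (\<Sum>j\<in>S. real_of_int (\<lfloor>t * d j\<rfloor> + n j) *\<^sub>R X j)"
      by (intro sum.cong) auto
    also have "\<dots> = f + w" unfolding f_def n(1) by (simp add: scaleR_add_left sum.distrib)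
    also have "\<dots> = z - real q *\<^sub>R x" by (simp add: w_def)
    finally have "z - real q *\<^sub>R x = (\<Sum>j\<in>S. real (nat (\<lfloor>t * d j\<rfloor> + n j)) *\<^sub>R X j)" by simp
    then show "words S X (z - real q *\<^sub>R x) \<noteq> {}"
      unfolding words_nonempty_iff[OF \<open>finite S\<close>]
      by (rule exI[of _ "\<lambda>j. nat (\<lfloor>t * d j\<rfloor> + n j)"])
  qed
qed

text \<open>Disposes of the polynomial factor lost by deleting letters: its logarithm is
  sublinear.\<close>

lemma log_growth_negligible:
  fixes A B C e :: real
  assumes "C > 0" "e > 0"
  shows "\<exists>N. \<forall>k\<ge>N. k \<ge> 1 \<and> (A + B * ln (C * real k)) \<le> e * real k"
proof -
  have "(\<lambda>k. (A + B * ln C) / real k + B * (ln (real k) / real k)) \<longlonglongrightarrow> 0 + B * 0"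
    by (intro tendsto_intros lim_const_over_n lim_ln_over_n)
  then have "eventually (\<lambda>k. (A + B * ln C) / real k + B * (ln (real k) / real k) < e) sequentially"
    using assms by (intro order_tendstoD) auto
  then have "eventually (\<lambda>k. k \<ge> 1 \<and> (A + B * ln (C * real k)) \<le> e * real k) sequentially"
    using eventually_ge_at_top[of 1]
  proof eventually_elim
    case (elim k)
    then have "(A + B * ln (C * real k)) / real k < e"
      using assms by (simp add: ln_mult add_divide_distrib algebra_simps)
    then show ?case using elim by (simp add: pos_divide_less_eq less_imp_le)
  qed
  then show ?thesis by (simp add: eventually_sequentially)
qed

text \<open>Stated for arbitrary semigroup points at bounded distance from
  \<open>k *\<^sub>R \<theta>\<close>, so that it applies to whichever nearest points attain the
  minimum.\<close>

lemma log_card_words_convergent: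
  fixes X :: "nat \<Rightarrow> real ^ 's" and z :: "nat \<Rightarrow> real ^ 's"
  assumes "finite I" and int: "\<forall>j\<in>I. \<forall>i. X j $ i \<in> \<int>"
    and pos: "\<forall>j\<in>I. X j \<bullet> \<alpha> > 0"
    and c: "\<theta> = (\<Sum>j\<in>I. c j *\<^sub>R X j)" "\<forall>j\<in>I. c j \<ge> 0"
    and z: "\<And>k. words I X (z k) \<noteq> {}" "\<And>k. norm (z k - real k *\<^sub>R \<theta>) \<le> D"
  shows "convergent (\<lambda>k. ln (real (card (words I X (z k)))) / real k)"
proof -
  obtain \<delta> where \<delta>: "\<delta> > 0" "\<And>j. j \<in> I \<Longrightarrow> \<delta> \<le> X j \<bullet> \<alpha>"
    using finite_positive_lower_bound[of I "\<lambda>j. X j \<bullet> \<alpha>"] \<open>finite I\<close> pos by metis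
  interpret half_space_vectors I X \<alpha> \<delta> using \<open>finite I\<close> \<delta> by unfold_locales
  obtain S d a where S: "S \<subseteq> I" and d: "\<forall>i\<in>S. d i > 0" "\<theta> = (\<Sum>i\<in>S. d i *\<^sub>R X i)"
    and a: "a \<bullet> \<theta> = 0" "\<forall>i\<in>I. a \<bullet> X i \<ge> 0" "\<forall>i\<in>I - S. a \<bullet> X i > 0"
    by (rule minimal_face[OF \<open>finite I\<close> pos c])
  have "finite S" using S \<open>finite I\<close> finite_subset by blast
  have "D \<ge> 0" using norm_ge_zero z(2) by (rule order_trans)
  obtain B where B: "\<forall>w r z. w \<in> words I X z \<and> norm (z - r *\<^sub>R \<theta>) \<le> D
    \<longrightarrow> length (filter (\<lambda>j. j \<notin> S) w) \<le> B"
    by (rule few_letters_outside_face[OF \<open>finite I\<close> a])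
  define E where "E = (\<Sum>j\<in>I. norm (X j))"
  have E: "norm (X j) \<le> E" if "j \<in> I" for j
    unfolding E_def using that \<open>finite I\<close> by (intro member_le_sum) auto
  have "E \<ge> 0" by (simp add: E_def sum_nonneg)
  \<comment> \<open>Deleting at most \<open>B\<close> letters, each of norm at most
    \<open>E\<close>, enlarges the distance to this.\<close>
  define D' where "D' = D + real B * E"
  have shift: "norm (z k - sum_list (map X u) - real k *\<^sub>R \<theta>) \<le> D'"
    if "set u \<subseteq> I" "length u \<le> B" for u k
  proof -
    have "norm (sum_list (map X u)) \<le> real (length u) * E"
      using that(1) E by (rule norm_sum_list_map_le)
    also have "\<dots> \<le> real B * E" using that(2) \<open>E \<ge> 0\<close> by (intro mult_right_mono) auto
    finally have "norm (sum_list (map X u)) \<le> real B * E" .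
    moreover have "norm (z k - sum_list (map X u) - real k *\<^sub>R \<theta>)
        \<le> norm (z k - real k *\<^sub>R \<theta>) + norm (sum_list (map X u))"
      using norm_triangle_ineq4[of "z k - real k *\<^sub>R \<theta>" "sum_list (map X u)"] by (simp add: algebra_simps)
    ultimately show ?thesis using z(2)[of k] by (simp add: D'_def)
  qed
  define M where "M = (norm \<theta> + D) * norm \<alpha> / \<delta>"
  have "M \<ge> 0" using \<open>D \<ge> 0\<close> \<delta>(1) by (simp add: M_def)
  have len: "real (nat \<lfloor>(z k \<bullet> \<alpha>) / \<delta>\<rfloor>) \<le> M * real k" if "k \<ge> 1" for k
  proof -
    have "norm (z k) \<le> norm (real k *\<^sub>R \<theta>) + norm (z k - real k *\<^sub>R \<theta>)"
      by (rule norm_triangle_sub)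
    also have "\<dots> \<le> real k * norm \<theta> + real k * D"
      using z(2)[of k] that \<open>D \<ge> 0\<close> mult_right_mono[of 1 "real k" D] by simp
    finally have zk: "norm (z k) \<le> real k * (norm \<theta> + D)" by (simp add: algebra_simps)
    have "z k \<bullet> \<alpha> \<le> norm (z k) * norm \<alpha>" by (rule norm_cauchy_schwarz)
    also have "\<dots> \<le> (real k * (norm \<theta> + D)) * norm \<alpha>" using zk by (rule mult_right_mono) simp
    finally have "z k \<bullet> \<alpha> / \<delta> \<le> (real k * (norm \<theta> + D)) * norm \<alpha> / \<delta>"
      using \<delta>(1) by (intro divide_right_mono) auto
    also have "\<dots> = M * real k" by (simp add: M_def)
    finally have "z k \<bullet> \<alpha> / \<delta> \<le> M * real k" .
    moreover have "0 \<le> M * real k" using \<open>M \<ge> 0\<close> by simp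
    ultimately show ?thesis by linarith
  qed
  define g where "g k = ln (real (card (words I X (z k))))" for k
  define C where "C = M * ln (real (card I) + 1)"
  have "C \<ge> 0" using \<open>M \<ge> 0\<close> by (simp add: C_def)
  have card_pos: "card (words I X (z k)) \<ge> 1" for k
    using card_words_pos_iff[of I "z k"] z(1)[of k] by simp
  have g_nonneg: "g k \<ge> 0" for k using card_pos[of k] by (simp add: g_def)
  have g_le: "g k \<le> C * real k" if "k \<ge> 1" for k
  proof -
    have "real (card (words I X (z k))) \<le> (real (card I) + 1) ^ nat \<lfloor>(z k \<bullet> \<alpha>) / \<delta>\<rfloor>"
      using of_nat_mono[OF card_words_le[of "z k"], where 'a=real] by (simp add: add.commute)
    then have "g k \<le> ln ((real (card I) + 1) ^ nat \<lfloor>(z k \<bullet> \<alpha>) / \<delta>\<rfloor>)"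
      unfolding g_def using card_pos[of k] by (intro ln_mono) auto
    also have "\<dots> = real (nat \<lfloor>(z k \<bullet> \<alpha>) / \<delta>\<rfloor>) * ln (real (card I) + 1)" by (simp add: ln_realpow)
    also have "\<dots> \<le> (M * real k) * ln (real (card I) + 1)" using len[OF that] by (intro mult_right_mono) auto
    finally show ?thesis by (simp add: C_def mult_ac)
  qed
  have above: "\<exists>K. \<forall>k0\<ge>K. \<exists>N. \<forall>k\<ge>N. g k / real k \<ge> g k0 / real k0 - e" if "e > 0" for e
  proof -
    \<comment> \<open>The fraction \<open>e'\<close> of \<open>k\<close> is kept as slack. Since the
      growth rate is at most \<open>C\<close>, this costs at most \<open>e / 4\<close>; the bound
      1/2 keeps \<open>e'\<close> below 1.\<close>
    define e' where "e' = min (1/2) (e / (4 * (C + 1)))"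
    have e': "0 < e'" "e' < 1" using \<open>e > 0\<close> \<open>C \<ge> 0\<close> by (auto simp: e'_def)
    have e'C: "e' * C \<le> e / 4"
    proof -
      have "e' * C \<le> e' * (C + 1)" using e' by (intro mult_left_mono) auto
      also have "\<dots> \<le> e / (4 * (C + 1)) * (C + 1)" using \<open>C \<ge> 0\<close> by (intro mult_right_mono) (auto simp: e'_def)
      also have "\<dots> = e / 4" using \<open>C \<ge> 0\<close> by (simp add: field_simps)
      finally show ?thesis .
    qed
    have int_S: "\<forall>j\<in>S. \<forall>i. X j $ i \<in> \<int>" using int S by blast
    obtain K0 N :: nat where absorb:
      "\<forall>k0\<ge>K0. \<forall>k\<ge>N. \<forall>x z q.
         words S X x \<noteq> {} \<and> norm (x - real k0 *\<^sub>R \<theta>) \<le> D' \<and>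
         words S X z \<noteq> {} \<and> norm (z - real k *\<^sub>R \<theta>) \<le> D' \<and> real q * real k0 \<le> (1 - e') * real k
       \<longrightarrow> words S X (z - real q *\<^sub>R x) \<noteq> {}"
      by (rule absorb_multiples[OF \<open>finite S\<close> int_S d e'])
    obtain K1 where K1: "\<And>k. k \<ge> K1 \<Longrightarrow> k \<ge> 1 \<and>
        real B * ln (real (card I) + 1) + real B * ln ((M + 1) * real k) \<le> e / 4 * real k"
      using log_growth_negligible[of "M + 1" "e / 4"] \<open>M \<ge> 0\<close> \<open>e > 0\<close> by fastforce
    show ?thesis
    proof (rule exI[of _ "max K0 K1"], intro allI impI)
      fix k0 assume k0: "k0 \<ge> max K0 K1"
      then have "k0 \<ge> 1" using K1[of k0] by simp
      obtain u where u: "set u \<subseteq> I" "length u \<le> B" "words S X (z k0 - sum_list (map X u)) \<noteq> {}"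
        "card (words I X (z k0)) \<le> (card I + 1) ^ B * (nat \<lfloor>(z k0 \<bullet> \<alpha>) / \<delta>\<rfloor> + 1) ^ B
            * card (words S X (z k0 - sum_list (map X u)))"
      proof (rule card_words_le_restrict[OF S z(1)[of k0]])
        show "\<forall>w\<in>words I X (z k0). length (filter (\<lambda>j. j \<notin> S) w) \<le> B" using B z(2)[of k0] by blast
      qed
      define x where "x = z k0 - sum_list (map X u)"
      define L where "L = ln (real (card (words S X x)))"
      have x_pos: "card (words S X x) \<ge> 1"
        using u(3) card_words_pos_iff[OF S, of x] by (simp add: x_def)
      then have "L \<ge> 0" by (simp add: L_def)
      \<comment> \<open>The reverse comparison, free of any polynomial factor: appending the fixed
        word \<open>v\<close> keeps words distinct.\<close>
      have mono: "card (words S X (y - sum_list (map X v))) \<le> card (words I X y)" if "set v \<subseteq> I" for v y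
      proof -
        have "card (words S X (y - sum_list (map X v))) \<le> card (words I X (y - sum_list (map X v)))"
          using S finite_words[of I] by (intro card_mono) (auto simp: words_def)
        also have "\<dots> \<le> card (words I X (y - sum_list (map X v) + sum_list (map X v)))"
          using that by (intro card_words_add_ge) (auto simp: words_def)
        finally show ?thesis by simp
      qed
      have "L \<le> g k0"
        unfolding L_def g_def x_def using mono[OF u(1), of "z k0"] x_pos by (intro ln_mono) (auto simp: x_def)
      have g_L: "g k0 \<le> e / 4 * real k0 + L"
      proof -
        let ?n = "nat \<lfloor>(z k0 \<bullet> \<alpha>) / \<delta>\<rfloor>"
        have "real (card (words I X (z k0))) \<le>
            (real (card I) + 1) ^ B * (real ?n + 1) ^ B * real (card (words S X x))"
          using of_nat_mono[OF u(4), where 'a=real] by (simp add: x_def add.commute)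
        then have "g k0 \<le> ln ((real (card I) + 1) ^ B * (real ?n + 1) ^ B * real (card (words S X x)))"
          unfolding g_def using card_pos[of k0] by (intro ln_mono) auto
        also have "\<dots> = real B * ln (real (card I) + 1) + real B * ln (real ?n + 1) + L"
          using x_pos by (simp add: ln_mult ln_realpow L_def)
        also have "\<dots> \<le> real B * ln (real (card I) + 1) + real B * ln ((M + 1) * real k0) + L"
        proof -
          have "real ?n + 1 \<le> (M + 1) * real k0" using len[OF \<open>k0 \<ge> 1\<close>] \<open>k0 \<ge> 1\<close> by (simp add: algebra_simps)
          then have "ln (real ?n + 1) \<le> ln ((M + 1) * real k0)" by (intro ln_mono) auto
          then show ?thesis by (intro add_mono mult_left_mono) auto
        qed
        also have "\<dots> \<le> e / 4 * real k0 + L" using K1[of k0] k0 by simp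
        finally show ?thesis .
      qed
      show "\<exists>N. \<forall>k\<ge>N. g k / real k \<ge> g k0 / real k0 - e"
      \<comment> \<open>Rounding \<open>q\<close> down loses at most one copy of \<open>x\<close>,
        which costs \<open>L / k\<close>; this threshold makes it at most
        \<open>e / 4\<close>.\<close>
      proof (intro exI[of _ "max N (nat \<lceil>4 * L / e\<rceil> + 1)"] allI impI)
        fix k assume k: "k \<ge> max N (nat \<lceil>4 * L / e\<rceil> + 1)"
        then have "k \<ge> 1" by simp
        have "4 * L / e \<le> real k" using k by linarith
        then have kL: "L / real k \<le> e / 4"
          using \<open>e > 0\<close> \<open>k \<ge> 1\<close> by (simp add: field_simps)
        define q where "q = nat \<lfloor>(1 - e') * real k / real k0\<rfloor>"
        have q_le: "real q \<le> (1 - e') * real k / real k0"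
          unfolding q_def using e' by (intro of_nat_floor) auto
        have q_ge: "real q \<ge> (1 - e') * real k / real k0 - 1" unfolding q_def by linarith
        have qk: "real q * real k0 \<le> (1 - e') * real k"
          using q_le \<open>k0 \<ge> 1\<close> by (simp add: pos_le_divide_eq)
        \<comment> \<open>Any word for \<open>z k\<close> serves: deleting its letters outside
          \<open>S\<close> leaves a point \<open>y\<close> of the face semigroup from which the
          copies of \<open>x\<close> can be subtracted.\<close>
        obtain w where w: "w \<in> words I X (z k)" using z(1)[of k] by auto
        define v where "v = filter (\<lambda>j. j \<notin> S) w"
        have v: "set v \<subseteq> I" using w by (auto simp: v_def words_def)
        have v_len: "length v \<le> B" unfolding v_def using w B z(2)[of k] by blast
        define y where "y = z k - sum_list (map X v)"
        have "words S X y \<noteq> {}" using filter_in_words[OF w, of S] by (auto simp: y_def v_def)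
        then have "words S X (y - real q *\<^sub>R x) \<noteq> {}"
          using k k0 u v v_len qk shift by (intro absorb[rule_format, of k0 k x]) (auto simp: x_def y_def)
        then have "card (words S X x) ^ q \<le> card (words S X (real q *\<^sub>R x + (y - real q *\<^sub>R x)))"
          by (rule card_words_power_le[OF S])
        also have "\<dots> \<le> card (words I X (z k))" using mono[OF v, of "z k"] by (simp add: y_def)
        finally have "real (card (words S X x) ^ q) \<le> real (card (words I X (z k)))" by (rule of_nat_mono)
        then have "ln (real (card (words S X x) ^ q)) \<le> g k"
          unfolding g_def using x_pos by (intro ln_mono) auto
        then have "real q * L \<le> g k" using x_pos by (simp add: ln_realpow L_def)
        moreover have "((1 - e') * real k / real k0 - 1) * L \<le> real q * L"
          using q_ge \<open>L \<ge> 0\<close> by (rule mult_right_mono)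
        ultimately have "((1 - e') * real k / real k0 - 1) * L / real k \<le> g k / real k"
          by (intro divide_right_mono) auto
        moreover have "((1 - e') * real k / real k0 - 1) * L / real k = L / real k0 - e' * (L / real k0) - L / real k"
          using \<open>k \<ge> 1\<close> \<open>k0 \<ge> 1\<close> by (simp add: field_simps)
        moreover have "e' * (L / real k0) \<le> e / 4"
        proof -
          have "L / real k0 \<le> C"
            using \<open>L \<le> g k0\<close> g_le[OF \<open>k0 \<ge> 1\<close>] \<open>k0 \<ge> 1\<close> by (simp add: pos_divide_le_eq)
          then have "e' * (L / real k0) \<le> e' * C" using e' by (intro mult_left_mono) auto
          then show ?thesis using e'C by (rule order_trans)
        qed
        moreover have "g k0 / real k0 \<le> e / 4 + L / real k0"
          using divide_right_mono[OF g_L, of "real k0"] \<open>k0 \<ge> 1\<close> by (simp add: add_divide_distrib)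
        \<comment> \<open>Three losses of at most \<open>e / 4\<close> each: the slack, the rounding
          of \<open>q\<close>, and the restriction to \<open>S\<close> at \<open>k0\<close>.\<close>
        ultimately show "g k / real k \<ge> g k0 / real k0 - e" using kL \<open>e > 0\<close> by linarith
      qed
    qed
  qed
  \<comment> \<open>At \<open>k = 0\<close> division by zero gives 0, which \<open>C \<ge> 0\<close>
    covers.\<close>
  have "\<bar>g k / real k\<bar> \<le> C" for k
    using g_nonneg[of k] g_le[of k] \<open>C \<ge> 0\<close> by (cases "k = 0") (auto simp: pos_divide_le_eq)
  then have "convergent (\<lambda>k. g k / real k)"
    using above by (rule convergent_if_eventually_almost_above)
  then show ?thesis by (simp add: g_def)
qed

section \<open>Nearest points of the semigroup\<close>

theorem theorem1p2:
  fixes m :: nat and X :: "nat \<Rightarrow> real ^ 's" and \<alpha> \<theta> :: "real ^ 's"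
  assumes "m \<ge> 2"
    and "\<forall>j\<in>{1..m}. \<forall>i. X j $ i \<in> \<int>"
    and "span (X ` {1..m}) = UNIV"
    and "\<forall>j\<in>{1..m}. X j \<bullet> \<alpha> > 0"
    and "\<theta> \<in> cone_C m X"
    and "norm \<theta> = 1"
  shows "convergent (\<lambda>k :: nat. ln (real (nearest_mult m X (real k *\<^sub>R \<theta>))) / real k)"
proof -
  define J where "J = semigroup_J m X"
  define D where "D = (\<Sum>j=1..m. norm (X j))"
  obtain c where c: "\<theta> = (\<Sum>j=1..m. c j *\<^sub>R X j)" "\<forall>j\<in>{1..m}. c j \<ge> 0"
    using assms(5) by (auto simp: cone_C_def)
  have "J \<subseteq> {x. \<forall>i. x $ i \<in> \<int>}"
    unfolding J_def semigroup_J_def using assms(2) by (auto intro!: Ints_sum Ints_mult)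
  then have "closed J"
    using uniform_discrete_integral_vectors uniform_discrete_subset uniform_discrete_imp_closed by blast
  \<comment> \<open>Rounding down the nonnegative coefficients of
    \<open>k *\<^sub>R \<theta>\<close> yields a semigroup point within \<open>D\<close>, a bound
    independent of \<open>k\<close>.\<close>
  have near: "infdist (real k *\<^sub>R \<theta>) J \<le> D" for k
  proof -
    define n where "n j = nat \<lfloor>real k * c j\<rfloor>" for j
    have eq: "(\<Sum>j=1..m. real (n j) *\<^sub>R X j) = (\<Sum>j=1..m. real_of_int \<lfloor>real k * c j\<rfloor> *\<^sub>R X j)"
      using c(2) by (intro sum.cong) (auto simp: n_def)
    have "(\<Sum>j=1..m. real (n j) *\<^sub>R X j) \<in> J" by (auto simp: J_def semigroup_J_def)
    then have "infdist (real k *\<^sub>R \<theta>) J \<le> dist (real k *\<^sub>R \<theta>) (\<Sum>j=1..m. real (n j) *\<^sub>R X j)"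
      by (rule infdist_le)
    also have "\<dots> \<le> D"
      using norm_floor_combination_le[of "\<lambda>j. real k * c j" X "{1..m}"]
      unfolding dist_norm eq by (simp add: c(1) D_def scaleR_sum_right)
    finally show ?thesis .
  qed
  have "\<exists>z. z \<in> J \<and> norm (real k *\<^sub>R \<theta> - z) \<le> D \<and> nearest_mult m X (real k *\<^sub>R \<theta>) = word_mult m X z" for k
  proof -
    \<comment> \<open>The distance is attained because \<open>J\<close> is closed, so
      \<open>Inf\<close> ranges over a nonempty set of naturals and is the multiplicity of some
      nearest point.\<close>
    define A where "A = {z \<in> J. norm (real k *\<^sub>R \<theta> - z) = infdist (real k *\<^sub>R \<theta>) J}"
    have "J \<noteq> {}" by (auto simp: J_def semigroup_J_def)
    then obtain y where "y \<in> J" "infdist (real k *\<^sub>R \<theta>) J = dist (real k *\<^sub>R \<theta>) y"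
      using infdist_attains_inf[OF \<open>closed J\<close>] by blast
    then have "word_mult m X ` A \<noteq> {}" by (auto simp: A_def dist_norm)
    then have "Inf (word_mult m X ` A) \<in> word_mult m X ` A" by (rule Inf_nat_def1)
    then obtain z where "z \<in> A" "Inf (word_mult m X ` A) = word_mult m X z" by auto
    then show ?thesis using near[of k] by (auto simp: A_def nearest_mult_def J_def)
  qed
  then obtain z where z: "\<And>k. z k \<in> J" "\<And>k. norm (real k *\<^sub>R \<theta> - z k) \<le> D"
    "\<And>k. nearest_mult m X (real k *\<^sub>R \<theta>) = word_mult m X (z k)"
    by metis
  have "convergent (\<lambda>k. ln (real (card (words {1..m} X (z k)))) / real k)"
  proof (rule log_card_words_convergent[OF _ assms(2,4) c])
    show "words {1..m} X (z k) \<noteq> {}" for k using z(1)[of k] by (simp add: J_def semigroup_J_eq)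
    show "norm (z k - real k *\<^sub>R \<theta>) \<le> D" for k using z(2)[of k] by (simp add: norm_minus_commute)
  qed simp
  then show ?thesis by (simp add: z(3) word_mult_eq_card_words)
qed

end
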